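(* Let $k\ge 1$ and $n\ge 2$ be integers and let $S(2k,n)=\sum_{j=1}^{2^{n-2}}\frac{1}{\sin^{2k}\left(\frac{(2j-1)\pi}{2^n}\right)}$. Then $$S(2k,n)=\sum_{j=1}^k(-1)^{k+1}\frac{2^{2j(n-1)+2k-1}(2^{2j}-1)}{(2(k-j))!\,(2j)!}B_{2(k-j)}^{(2k)}(k)\,B(2j)=\sum_{j=1}^k(-1)^{j+k}\frac{2^{2j(n-2)+2k}(2^{2j}-1)}{\pi^{2j}(2(k-j))!}B_{2(k-j)}^{(2k)}(k)\,\zeta(2j).$$ Equivalently, $$S(2k,n)=(-1)^{k+1}\frac{2^{2k-1}}{(2k)!}\sum_{j=1}^k2^{2jn}\,\frac{2^{2j}-1}{2^{2j}}\binom{2k}{2j}B_{2(k-j)}^{(2k)}(k)\,B(2j).$$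
   Context: The generalized Bernoulli polynomials $B_n^{(\alpha)}(x)$ are defined by $\left(\frac{t}{e^t-1}\right)^\alpha e^{xt}=\sum_{n\ge 0} B_n^{(\alpha)}(x)\frac{t^n}{n!}$. $B(j)$ denotes the $j$-th Bernoulli number ($B(2)=\tfrac16$, $B(4)=-\tfrac1{30}$, etc.), and $\zeta$ is the Riemann zeta function. *)

theory Defs
  imports "HOL-Analysis.Analysis" "HOL-Computational_Algebra.Computational_Algebra"
begin

text \<open>
  The series \<open>t / (e\<^sup>t - 1)\<close>. The divisor has zero constant term, so the quotient is not a
  product with an inverse; that it is the genuine quotient is \<open>bernoulli_fps_mult\<close> below.
\<close>
definition bernoulli_fps :: "'a :: field_char_0 fps" where
  "bernoulli_fps = fps_X / (fps_exp 1 - 1)"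

definition bernoulli :: "nat \<Rightarrow> 'a :: field_char_0" where
  "bernoulli n = fact n * fps_nth bernoulli_fps n"

text \<open>
  The exponent \<open>\<alpha>\<close> is an arbitrary scalar: since \<open>bernoulli_fps\<close> has constant term 1, its
  \<open>\<alpha>\<close>-th power is the binomial series \<open>(1 + X)\<^sup>\<alpha>\<close> composed with \<open>bernoulli_fps - 1\<close>. For a
  natural number \<open>\<alpha>\<close> this is the ordinary power, see \<open>bernoulli_gen_of_nat\<close>.
\<close>
definition bernoulli_gen :: "'a \<Rightarrow> nat \<Rightarrow> 'a \<Rightarrow> 'a :: field_char_0" where
  "bernoulli_gen \<alpha> n x =
     fact n * fps_nth ((fps_binomial \<alpha> oo (bernoulli_fps - 1)) * fps_exp x) n"

text \<open>
  The Dirichlet series defines the zeta function for \<open>s > 1\<close>; no other arguments are needed, and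
  for \<open>s \<le> 1\<close> the value below is not meaningful.
\<close>
definition riemann_zeta :: "real \<Rightarrow> real" where
  "riemann_zeta s = (\<Sum>n. 1 / real (Suc n) powr s)"

definition csc_power_sum :: "nat \<Rightarrow> nat \<Rightarrow> real" where
  "csc_power_sum m n = (\<Sum>j=1..2^(n-2). 1 / sin ((2 * real j - 1) * pi / 2^n) ^ m)"

lemma bernoulli_fps_mult: "bernoulli_fps * (fps_exp 1 - 1) = (fps_X :: 'a :: field_char_0 fps)"
proof -
  let ?e = "fps_exp 1 - 1 :: 'a fps"
  have "?e $ 1 \<noteq> 0" by simp
  then have "?e \<noteq> 0" by (metis fps_zero_nth)
  moreover have "subdegree ?e = 1" by (rule subdegreeI) auto
  ultimately have "?e dvd fps_X" by (subst fps_dvd_iff) auto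
  then show ?thesis by (simp add: bernoulli_fps_def)
qed

lemma bernoulli_fps_nth_0: "fps_nth bernoulli_fps 0 = (1 :: 'a :: field_char_0)"
proof -
  have "fps_nth (bernoulli_fps * (fps_exp 1 - 1)) 1 = fps_nth (fps_X :: 'a fps) 1"
    by (simp only: bernoulli_fps_mult)
  then show ?thesis by (simp add: fps_mult_nth_1)
qed

lemma bernoulli_gen_of_nat:
  "bernoulli_gen (of_nat m) n (x :: 'a :: field_char_0) =
     fact n * fps_nth (bernoulli_fps ^ m * fps_exp x) n"
proof -
  have "fps_binomial (of_nat m) oo (bernoulli_fps - 1) = (bernoulli_fps ^ m :: 'a fps)"
    using bernoulli_fps_nth_0[where ?'a = 'a]
    by (simp add: fps_binomial_of_nat fps_compose_power[symmetric] fps_compose_add_distrib)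
  then show ?thesis by (simp add: bernoulli_gen_def)
qed

end

theory Submission
  imports Defs
begin

text \<open>
  For an \<open>N\<close>-th root \<open>z\<close> of \<open>- 1\<close>, \<open>N = 2\<^sup>p\<close> and \<open>p = n - 1\<close>, put
  \<open>g\<^sub>z = z e\<^sup>t / (z e\<^sup>t - 1)\<^sup>2\<close>. At \<open>t = 0\<close> this is \<open>- 1 / (4 sin\<^sup>2 (\<phi> / 2))\<close> when \<open>z = e\<^sup>i\<^sup>\<phi>\<close>, so
  the sum \<open>V\<^sub>k\<close> of all \<open>g\<^sub>z\<^sup>k\<close> is at \<open>t = 0\<close> a multiple of the cosecant sum. The powers satisfy
  \<open>2k (2k + 1) g\<^sup>k\<^sup>+\<^sup>1 = (g\<^sup>k)'' - k\<^sup>2 g\<^sup>k\<close>, which expresses \<open>V\<^sub>k\<close> by the even derivatives of \<open>V\<^sub>1\<close>.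
  The coefficients obey the same recurrence as those of \<open>(t / (2 sinh (t / 2)))\<^sup>2\<^sup>k\<close>, which are
  the \<open>B\<^sub>m\<^sup>(\<^sup>2\<^sup>k\<^sup>)(k) / m!\<close>. Pairing \<open>z\<close> with \<open>- z\<close> repeatedly gives
  \<open>V\<^sub>1 = N (1 / (e\<^sup>N\<^sup>t + 1))'\<close>, whose coefficients are Bernoulli numbers.
  Dividing the resulting formula by \<open>2\<^sup>2\<^sup>k\<^sup>n\<close> and letting \<open>n\<close> tend to infinity yields Euler's
  formula for \<open>\<zeta>(2k)\<close>, hence the zeta form of the identity.
\<close>

section \<open>Powers of (t / (2 sinh (t/2)))^2 and generalized Bernoulli numbers\<close>

text \<open>The series \<open>(t / (2 sinh (t / 2)))\<^sup>2\<close>.\<close>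
definition bern_sq :: "'a :: field_char_0 fps" where
  "bern_sq = bernoulli_fps ^ 2 * fps_exp 1"

text \<open>The argument k is half the exponent 2k, so each squared factor takes exactly one e^t and
  the generating series is a k-th power.\<close>

lemma bernoulli_gen_even:
  "bernoulli_gen (real (2*k)) m (real k) = fact m * fps_nth (bern_sq ^ k) m"
  unfolding bernoulli_gen_of_nat bern_sq_def
  by (simp add: power_mult_distrib power_mult fps_exp_power_mult)

text \<open>Differentiate b (e^t - 1) = t and multiply the result by b.\<close>

lemma X_mult_deriv_bernoulli_fps:
  "fps_X * fps_deriv bernoulli_fps = bernoulli_fps - (bern_sq :: 'a :: field_char_0 fps)"
proof -
  let ?b = "bernoulli_fps :: 'a fps" and ?E = "fps_exp 1 :: 'a fps"
  have eq: "?b * (?E - 1) = fps_X" by (rule bernoulli_fps_mult)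
  then have "fps_deriv (?b * (?E - 1)) = 1" by simp
  then have "fps_deriv ?b * (?E - 1) + ?b * ?E = 1"
    by (simp add: algebra_simps)
  moreover have "x * b' = b - b ^ 2 * e" if "b' * (e - 1) + b * e = 1" "b * (e - 1) = x"
    for x b b' e :: "'a fps"
    using that by algebra
  ultimately show ?thesis using eq unfolding bern_sq_def by blast
qed

text \<open>Write D = t d/dt and c = 2b + t = t coth (t/2). The relations D G = G (2 - c), D c = c -
  2G and c^2 = 4G + t^2 express D (D (G^k)) through c and G. Eliminating c^2 produces G^(k+1), and
  the part linear in c is cancelled by (4k + 1) D (G^k).\<close>

lemma bern_sq_power_Suc:
  fixes G :: "'a :: field_char_0 fps"
  defines "G \<equiv> bern_sq"
  shows "of_nat (2 * k * (2 * k + 1)) * G ^ Suc k =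
     fps_X * fps_deriv (fps_X * fps_deriv (G ^ k)) - of_nat (4 * k + 1) * (fps_X * fps_deriv (G ^ k))
     + of_nat (2 * k * (2 * k + 1)) * G ^ k - of_nat (k ^ 2) * (fps_X ^ 2 * G ^ k)"
proof -
  define b where "b = (bernoulli_fps :: 'a fps)"
  define D where "D = (\<lambda>F :: 'a fps. fps_X * fps_deriv F)"
  have D_mult: "D (F * F') = D F * F' + F * D F'" for F F'
    by (simp add: D_def algebra_simps)
  have D_add: "D (F + F') = D F + D F'" for F F'
    by (simp add: D_def algebra_simps)
  have D_const: "D (of_nat m) = 0" for m
    by (simp add: D_def)
  define x where "x = (fps_X :: 'a fps)"
  define c where "c = 2 * b + x"
  define e where "e = (fps_exp 1 :: 'a fps)"
  have b1: "b * (e - 1) = x" unfolding b_def e_def x_def by (rule bernoulli_fps_mult)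
  have G: "G = b ^ 2 * e" by (simp add: G_def bern_sq_def b_def e_def)
  have Db: "D b = b - G" unfolding D_def b_def G_def by (rule X_mult_deriv_bernoulli_fps)
  have DX: "D x = x" by (simp add: D_def x_def)
  have D2: "D (2 * F) = 2 * D F" for F
    using D_mult[of "of_nat 2" F] D_const[of 2] by simp
  have Dc: "D c = c - 2 * G"
  proof -
    have "D c = D (2 * b) + D x" unfolding c_def by (rule D_add)
    then show ?thesis unfolding D2 DX Db c_def by (simp add: algebra_simps)
  qed
  have "b * e = b + x" using b1 by (simp add: algebra_simps)
  then have "G = b * (b + x)" unfolding G by (simp add: power2_eq_square mult.assoc)
  then have c2: "c ^ 2 = 4 * G + x ^ 2" unfolding c_def by algebra
  have DG: "D G = G * (2 - c)"
  proof -
    have "D G = D (b * b) * e + b ^ 2 * (x * e)"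
      unfolding G power2_eq_square D_mult[of "b * b"] by (simp add: D_def e_def x_def)
    then show ?thesis unfolding D_mult Db using b1 G c_def by algebra
  qed
  have DGk: "D (G ^ k) = of_nat k * G ^ k * (2 - c)"
  proof (induction k)
    case 0 show ?case by (simp add: D_def)
  next
    case (Suc k) show ?case
      unfolding power_Suc D_mult Suc.IH DG by (simp add: algebra_simps)
  qed
  have "D (D (G ^ k)) = of_nat k * (D (G ^ k) * (2 - c) - G ^ k * D c)"
  proof -
    have "D (2 - c) = - D c"
      using D_const[of 2] by (simp add: D_def)
    then show ?thesis unfolding DGk D_mult D_const by (simp add: algebra_simps DGk)
  qed
  then have DDGk: "D (D (G ^ k)) = of_nat k * (of_nat k * G ^ k * (2 - c) ^ 2 - G ^ k * (c - 2 * G))"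
    unfolding DGk Dc by (simp add: power2_eq_square algebra_simps)
  have "2 * m * (2 * m + 1) * (G * q) = m * (m * q * (2 - c) ^ 2 - q * (c - 2 * G))
     - (4 * m + 1) * (m * q * (2 - c)) + 2 * m * (2 * m + 1) * q - m ^ 2 * (x ^ 2 * q)" for m q
    using c2 by algebra
  then have "of_nat (2 * k * (2 * k + 1)) * G ^ Suc k =
     D (D (G ^ k)) - of_nat (4 * k + 1) * D (G ^ k)
     + of_nat (2 * k * (2 * k + 1)) * G ^ k - of_nat (k ^ 2) * (x ^ 2 * G ^ k)"
    unfolding DDGk unfolding DGk of_nat_mult of_nat_add of_nat_power of_nat_numeral of_nat_1 power_Suc by blast
  then show ?thesis by (simp add: D_def x_def)
qed

text \<open>Since t d/dt multiplies the r-th coefficient by r, the operator acts as r^2 - (4k + 1) r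
  + 2k (2k + 1), which factors as (r - 2k) (r - 2k - 1).\<close>

lemma bern_sq_power_Suc_nth:
  fixes k r :: nat
  shows "of_nat (2 * k * (2 * k + 1)) * fps_nth (bern_sq ^ Suc k) r =
    (of_nat r - of_nat (2 * k)) * (of_nat r - of_nat (2 * k + 1)) * fps_nth (bern_sq ^ k) r
     - of_nat (k ^ 2) * (if r < 2 then 0 else fps_nth (bern_sq ^ k) (r - 2) :: 'a :: field_char_0)"
proof -
  have X: "fps_nth (fps_X * fps_deriv F) r = of_nat r * fps_nth F r" for F :: "'a fps"
    by (cases r) auto
  have c: "fps_nth (of_nat m * F) r = of_nat m * fps_nth F r" for F :: "'a fps" and m
    by (metis fps_mult_left_const_nth fps_of_nat)
  show ?thesis
    using arg_cong[OF bern_sq_power_Suc[of k, where ?'a = 'a], of "\<lambda>F. fps_nth F r"]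
    unfolding fps_sub_nth fps_add_nth c X fps_X_power_mult_nth
    by (simp add: algebra_simps of_nat_mult power2_eq_square)
qed

section \<open>Solving the recurrence for the powers\<close>

text \<open>
  Here \<open>v k s\<close> stands for the \<open>s\<close>-th derivative of \<open>V\<^sub>k\<close> at 0.
\<close>
lemma power_chain_sum:
  fixes v :: "nat \<Rightarrow> nat \<Rightarrow> 'a :: field_char_0"
  assumes rec: "\<And>k s. k \<ge> 1 \<Longrightarrow>
    of_nat (2 * k * (2 * k + 1)) * v (Suc k) s = v k (s + 2) - of_nat (k ^ 2) * v k s"
  assumes "k \<ge> 1"
  shows "v k s = (\<Sum>i<k. fps_nth (bern_sq ^ k) (2 * (k - 1 - i)) / fact (2 * i + 1) * v 1 (s + 2 * i))"
  using \<open>k \<ge> 1\<close>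
proof (induction k arbitrary: s rule: dec_induct)
  case base
  have "fps_nth (bern_sq :: 'a fps) 0 = 1"
    by (simp add: bern_sq_def bernoulli_fps_nth_0 fps_power_zeroth)
  then show ?case by simp
next
  case (step k)
  define p where "p = (\<lambda>k r. fps_nth (bern_sq ^ k) r :: 'a)"
  define c where "c = (of_nat (2 * k * (2 * k + 1)) :: 'a)"
  have "c \<noteq> 0" using step.hyps unfolding c_def of_nat_eq_0_iff by simp
  \<comment> \<open>At r = 2(k - i) the two linear factors are -2i and -(2i + 1). For i = k the
    index r is 0, so the shifted coefficient is absent.\<close>
  have p0: "c * p (Suc k) (2 * (k - i)) = of_nat (2 * i * (2 * i + 1)) * p k (2 * (k - i))
      - of_nat (k ^ 2) * (if i < k then p k (2 * (k - 1 - i)) else 0)" if "i \<le> k" for i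
  proof -
    have "(of_nat (2 * (k - i)) :: 'a) = 2 * of_nat k - 2 * of_nat i" 
      using that by (simp add: of_nat_diff)
    moreover have "2 * (k - i) - 2 = 2 * (k - 1 - i)" "2 * (k - i) < 2 \<longleftrightarrow> \<not> i < k"
      using that by auto
    ultimately show ?thesis
      unfolding c_def p_def bern_sq_power_Suc_nth
      by (cases "i = k") (use that in \<open>auto simp: algebra_simps\<close>)
  qed
  define w where "w = (\<lambda>i. v 1 (s + 2 * i))"
  have fact_eq: "(fact (2 * Suc i + 1) :: 'a) = of_nat (2 * Suc i * (2 * Suc i + 1)) * fact (2 * i + 1)" for i
    by (simp add: algebra_simps)
  have "c * (\<Sum>i<Suc k. p (Suc k) (2 * (k - i)) / fact (2 * i + 1) * w i)
      = (\<Sum>i<Suc k. of_nat (2 * i * (2 * i + 1)) * p k (2 * (k - i)) / fact (2 * i + 1) * w i)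
        - (\<Sum>i<Suc k. of_nat (k ^ 2) * (if i < k then p k (2 * (k - 1 - i)) else 0) / fact (2 * i + 1) * w i)"
    unfolding sum_distrib_left sum_subtractf[symmetric]
  proof (rule sum.cong[OF refl])
    fix i assume "i \<in> {..<Suc k}"
    then have *: "i \<le> k" by simp
    have "c * (p (Suc k) (2 * (k - i)) / fact (2 * i + 1) * w i) = (c * p (Suc k) (2 * (k - i))) / fact (2 * i + 1) * w i"
      by simp
    then show "c * (p (Suc k) (2 * (k - i)) / fact (2 * i + 1) * w i) =
         of_nat (2 * i * (2 * i + 1)) * p k (2 * (k - i)) / fact (2 * i + 1) * w i -
         of_nat (k ^ 2) * (if i < k then p k (2 * (k - 1 - i)) else 0) / fact (2 * i + 1) * w i"
      unfolding p0[OF *] by (simp only: diff_divide_distrib left_diff_distrib)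
  qed
  \<comment> \<open>The term i = 0 vanishes. In the others 2i (2i + 1) cancels against (2i + 1)!,
    and shifting i gives the induction hypothesis at s + 2.\<close>
  also have "(\<Sum>i<Suc k. of_nat (2 * i * (2 * i + 1)) * p k (2 * (k - i)) / fact (2 * i + 1) * w i)
     = (\<Sum>i<k. p k (2 * (k - 1 - i)) / fact (2 * i + 1) * w (Suc i))"
  proof -
    have "of_nat (2 * Suc i * (2 * Suc i + 1)) * a / fact (2 * Suc i + 1) = a / fact (2 * i + 1)" for i and a :: 'a
      unfolding fact_eq using of_nat_eq_0_iff[of "2 * Suc i * (2 * Suc i + 1)", where ?'a = 'a]
      by (simp del: of_nat_mult of_nat_add fact_Suc)
    then show ?thesis unfolding sum.lessThan_Suc_shift by (simp del: of_nat_mult of_nat_add fact_Suc)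
  qed
  also have "\<dots> = v k (s + 2)"
    unfolding step.IH[of "s + 2"] by (simp add: p_def w_def algebra_simps)
  also have "(\<Sum>i<Suc k. of_nat (k ^ 2) * (if i < k then p k (2 * (k - 1 - i)) else 0) / fact (2 * i + 1) * w i)
     = of_nat (k ^ 2) * v k s"
    unfolding step.IH[of s] sum_distrib_left by (auto intro!: sum.cong simp: p_def w_def)
  also have "v k (s + 2) - of_nat (k ^ 2) * v k s = c * v (Suc k) s"
    unfolding c_def using rec[of k s] step.hyps by simp
  finally show ?case using \<open>c \<noteq> 0\<close> by (simp add: p_def w_def)
qed

section \<open>Reciprocals of z e^(ct) - 1 and their sum over the roots of -1\<close>

text \<open>The divisor has constant term z - 1, so for z different from 1 this is a true
  reciprocal.\<close>

definition exp_frac :: "'a \<Rightarrow> 'a \<Rightarrow> 'a :: field_char_0 fps" where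
  "exp_frac z c = inverse (fps_const z * fps_exp c - 1)"

text \<open>With \<open>u = z e\<^sup>c\<^sup>t\<close> this is \<open>u / (u - 1)\<^sup>2\<close>, that is, \<open>csch\<^sup>2 / 4\<close> at half the logarithm of \<open>u\<close>.\<close>
definition csch_sq :: "'a \<Rightarrow> 'a \<Rightarrow> 'a :: field_char_0 fps" where
  "csch_sq z c = exp_frac z c + exp_frac z c ^ 2"

lemma exp_frac_mult: "z \<noteq> 1 \<Longrightarrow> exp_frac z c * (fps_const z * fps_exp c - 1) = 1"
  unfolding exp_frac_def by (rule inverse_mult_eq_1) simp

text \<open>For u = z e^(ct), differentiate f (u - 1) = 1 and use f u = 1 + f.\<close>

lemma exp_frac_deriv:
  assumes "z \<noteq> 1"
  shows "fps_deriv (exp_frac z c) = - fps_const c * csch_sq z c"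
proof -
  let ?f = "exp_frac z c" and ?E = "fps_const z * fps_exp c"
  have 1: "?f * (?E - 1) = 1" using assms by (rule exp_frac_mult)
  then have "fps_deriv (?f * (?E - 1)) = 0" by simp
  then have "fps_deriv ?f * (?E - 1) + ?f * (fps_const c * ?E) = 0"
    by (simp add: algebra_simps)
  then show ?thesis unfolding csch_sq_def using 1 by algebra
qed

text \<open>From f' = -g and g = f + f^2 follow g' = -(1 + 2f) g and (1 + 2f)^2 = 1 + 4g. Hence
  (g^k)'' = k^2 (1 + 4g) g^k + 2k g^(k+1).\<close>

lemma csch_sq_power_Suc:
  fixes z :: "'a :: field_char_0"
  assumes "z \<noteq> 1"
  shows "of_nat (2 * k * (2 * k + 1)) * csch_sq z 1 ^ Suc k =
    fps_deriv (fps_deriv (csch_sq z 1 ^ k)) - of_nat (k ^ 2) * csch_sq z 1 ^ k"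
proof -
  define f where "f = exp_frac z 1"
  define g where "g = csch_sq z 1"
  have g: "g = f + f ^ 2" by (simp add: g_def f_def csch_sq_def)
  have df: "fps_deriv f = - g" using exp_frac_deriv[OF assms, of 1] by (simp add: f_def g_def)
  have dg: "fps_deriv g = - (1 + 2 * f) * g"
    unfolding g power2_eq_square fps_deriv_add fps_deriv_mult df by (simp add: algebra_simps g)
  have dgk: "fps_deriv (g ^ k) = - of_nat k * (1 + 2 * f) * g ^ k"
  proof (induction k)
    case (Suc k) show ?case
      unfolding power_Suc fps_deriv_mult Suc.IH dg by (simp add: algebra_simps)
  qed simp
  have df2: "fps_deriv (1 + 2 * f) = - 2 * g"
  proof -
    have "2 * f = f + f" by simp
    then show ?thesis by (simp add: df)
  qed
  have "fps_deriv (fps_deriv (g ^ k)) = - of_nat k * (- 2 * g * g ^ k + (1 + 2 * f) * fps_deriv (g ^ k))"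
    by (simp only: dgk fps_deriv_mult df2 fps_deriv_neg fps_deriv_of_nat) (simp add: algebra_simps)
  then have "fps_deriv (fps_deriv (g ^ k))
      = - of_nat k * (- 2 * g * g ^ k + (1 + 2 * f) * (- of_nat k * (1 + 2 * f) * g ^ k))"
    by (simp only: dgk)
  moreover have "of_nat (2 * k * (2 * k + 1)) * g ^ Suc k
      = - of_nat k * (- 2 * g * g ^ k + (1 + 2 * f) * (- of_nat k * (1 + 2 * f) * g ^ k)) - of_nat (k ^ 2) * g ^ k"
  proof -
    have "(2 * m * (2 * m + 1)) * (g * q)
      = - m * (- 2 * g * q + (1 + 2 * f) * (- m * (1 + 2 * f) * q)) - m ^ 2 * q" for m q
      unfolding g by algebra
    then show ?thesis
      unfolding of_nat_mult of_nat_add of_nat_power of_nat_numeral of_nat_1 power_Suc by blast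
  qed
  ultimately show ?thesis by (simp add: g_def)
qed

text \<open>In terms of u = z e^(ct) this is u/(u - 1)^2 - u/(u + 1)^2 = 4u^2/(u^2 - 1)^2.\<close>

lemma csch_sq_double:
  assumes "z ^ 2 \<noteq> 1"
  shows "csch_sq z c + csch_sq (- z) c = 4 * csch_sq (z ^ 2) (2 * c)"
proof -
  define u where "u = fps_const z * fps_exp c"
  define f where "f = exp_frac (z ^ 2) (2 * c)"
  have "z \<noteq> 1" "- z \<noteq> 1" using assms by (auto, metis power2_minus one_power2)
  have u2: "fps_const (z ^ 2) * fps_exp (2 * c) = u ^ 2"
    unfolding u_def power_mult_distrib fps_exp_power_mult by (simp add: fps_const_power)
  have 1: "exp_frac z c * (u - 1) = 1"
    using exp_frac_mult[OF \<open>z \<noteq> 1\<close>, of c] by (simp add: u_def)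
  have 2: "exp_frac (- z) c * (- u - 1) = 1"
    using exp_frac_mult[OF \<open>- z \<noteq> 1\<close>, of c] by (simp add: u_def flip: fps_const_neg)
  have 3: "f * (u ^ 2 - 1) = 1"
    using exp_frac_mult[OF assms, of "2 * c"] by (simp add: u2 f_def)
  have "exp_frac z c = f * (u + 1)" using 1 3 by algebra
  moreover have "exp_frac (- z) c = - f * (u - 1)" using 2 3 by algebra
  ultimately show ?thesis
    unfolding csch_sq_def f_def[symmetric] using 3 by algebra
qed

text \<open>Moving the index by half the range adds pi to the angle, so the roots pair up as z and
  -z. Their squares are the roots of the previous level, and each application of
  \<open>csch_sq_double\<close> contributes a factor 4 and doubles c.\<close>

lemma csch_sq_sum:
  fixes c :: complex
  shows "(\<Sum>j=1..2^p. csch_sq (cis ((2 * real j - 1) * pi / 2 ^ p)) c) = 4 ^ p * csch_sq (- 1) (2 ^ p * c)"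
proof (induction p arbitrary: c)
  case 0
  show ?case by (simp add: cis_pi)
next
  case (Suc p)
  define M :: nat where "M = 2 ^ p"
  define z where "z = (\<lambda>j. cis ((2 * real j - 1) * pi / 2 ^ Suc p))"
  have M: "real M = 2 ^ p" by (simp add: M_def)
  have z_shift: "z (j + M) = - z j" for j
  proof -
    have "(2 * real (j + M) - 1) * pi / 2 ^ Suc p = (2 * real j - 1) * pi / 2 ^ Suc p + pi"
      by (simp add: M field_simps)
    then show ?thesis by (simp add: z_def flip: cis_mult)
  qed
  have z_sq: "z j ^ 2 = cis ((2 * real j - 1) * pi / 2 ^ p)" for j
    unfolding z_def Complex.DeMoivre by (rule arg_cong[of _ _ cis]) simp
  \<comment> \<open>The 2^p-th power of z^2 is -1, which rules out z^2 = 1.\<close>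
  have z_ne: "z j ^ 2 \<noteq> 1" for j
  proof
    assume "z j ^ 2 = 1"
    then have "(z j ^ 2) ^ (2 ^ p) = 1" by simp
    moreover have "(z j ^ 2) ^ (2 ^ p) = cis (2 * pi * real j - pi)"
      unfolding z_sq Complex.DeMoivre by (rule arg_cong[of _ _ cis]) (simp add: field_simps)
    moreover have "cis (2 * pi * real j - pi) = - 1"
      by (simp add: cis_divide[symmetric] cis_multiple_2pi)
    ultimately show False by simp
  qed
  have "(\<Sum>j=1..2^Suc p. csch_sq (z j) c)
      = (\<Sum>j=1..M. csch_sq (z j) c) + (\<Sum>j=1+M..M+M. csch_sq (z j) c)"
    using sum.ub_add_nat[of 1 M "\<lambda>j. csch_sq (z j) c" M] by (simp add: M_def mult_2 add.commute)
  also have "(\<Sum>j=1+M..M+M. csch_sq (z j) c) = (\<Sum>j=1..M. csch_sq (- z j) c)"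
    unfolding sum.shift_bounds_cl_nat_ivl z_shift ..
  also have "(\<Sum>j=1..M. csch_sq (z j) c) + (\<Sum>j=1..M. csch_sq (- z j) c)
      = (\<Sum>j=1..M. 4 * csch_sq (z j ^ 2) (2 * c))"
    by (simp only: sum.distrib[symmetric] csch_sq_double[OF z_ne])
  also have "\<dots> = 4 * (4 ^ p * csch_sq (- 1) (2 ^ p * (2 * c)))"
    unfolding sum_distrib_left[symmetric] z_sq M_def Suc.IH ..
  finally show ?case by (simp add: z_def mult.assoc mult.left_commute)
qed

section \<open>Bernoulli numbers as coefficients at z = -1\<close>

text \<open>Substitute ct for t in \<open>bernoulli_fps_mult\<close>.\<close>

lemma bernoulli_fps_scaled:
  "Abs_fps (\<lambda>n. c ^ n * fps_nth bernoulli_fps n) * (fps_exp c - 1) = fps_const c * (fps_X :: 'a :: field_char_0 fps)"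
proof -
  let ?L = "fps_const c * (fps_X :: 'a fps)"
  have "(bernoulli_fps * (fps_exp 1 - 1)) oo ?L = fps_X oo ?L"
    by (simp only: bernoulli_fps_mult)
  then have "(bernoulli_fps oo ?L) * ((fps_exp 1 oo ?L) - (1 oo ?L)) = ?L"
    by (simp add: fps_compose_mult_distrib fps_compose_sub_distrib)
  moreover have "fps_exp 1 oo ?L = fps_exp c"
    by (simp add: fps_compose_linear fps_eq_iff)
  moreover have "1 oo ?L = 1" by (rule fps_compose_1)
  ultimately have "(bernoulli_fps oo ?L) * (fps_exp c - 1) = ?L" by simp
  then show ?thesis unfolding fps_compose_linear .
qed

text \<open>With E = e^(ct), -1/(E + 1) = 2/(E^2 - 1) - 1/(E - 1). After multiplication by ct the
  right side is the Bernoulli series at 2ct minus the one at ct.\<close>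

lemma exp_frac_minus_one_nth:
  fixes c :: "'a :: field_char_0"
  assumes "c \<noteq> 0"
  shows "c * fps_nth (exp_frac (- 1) c) r = (2 ^ Suc r - 1) * c ^ Suc r * fps_nth bernoulli_fps (Suc r)"
proof -
  define E where "E = fps_exp c"
  define a where "a = Abs_fps (\<lambda>n. c ^ n * fps_nth bernoulli_fps n)"
  define d where "d = Abs_fps (\<lambda>n. (2 * c) ^ n * fps_nth bernoulli_fps n)"
  have E2: "fps_exp (2 * c) = E ^ 2"
    unfolding E_def fps_exp_power_mult by simp
  have 1: "a * (E - 1) = fps_const c * fps_X"
    unfolding a_def E_def by (rule bernoulli_fps_scaled)
  have 2: "d * (E ^ 2 - 1) = 2 * (fps_const c * fps_X)"
    unfolding d_def E2[symmetric] bernoulli_fps_scaled by (simp add: numeral_fps_const mult.assoc[symmetric])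
  have 3: "exp_frac (- 1) c * (- E - 1) = 1"
    using exp_frac_mult[of "- 1" c] by (simp add: E_def flip: fps_const_neg)
  have "(fps_const c * fps_X * exp_frac (- 1) c) * (E ^ 2 - 1) = (d - a) * (E ^ 2 - 1)"
    using 1 2 3 by algebra
  moreover have "E ^ 2 - 1 \<noteq> 0"
  proof
    assume "E ^ 2 - 1 = 0"
    then have "fps_nth (fps_exp (2 * c) - 1) 1 = 0" unfolding E2 by simp
    then show False using assms by simp
  qed
  ultimately have "fps_const c * fps_X * exp_frac (- 1) c = d - a" by simp
  then have "fps_nth (fps_const c * fps_X * exp_frac (- 1) c) (Suc r) = fps_nth (d - a) (Suc r)"
    by simp
  then show ?thesis
    by (simp add: mult.assoc a_def d_def algebra_simps power_mult_distrib)
qed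

text \<open>By \<open>exp_frac_deriv\<close>, compare coefficients in the derivative of
  \<open>exp_frac\<close>. One factor c comes from that derivative, the other from
  \<open>exp_frac_minus_one_nth\<close>.\<close>

lemma csch_sq_minus_one_nth:
  fixes c :: "'a :: field_char_0"
  assumes "c \<noteq> 0"
  shows "c ^ 2 * fps_nth (csch_sq (- 1) c) s
    = - of_nat (Suc s) * (2 ^ (s + 2) - 1) * c ^ (s + 2) * fps_nth bernoulli_fps (s + 2)"
proof -
  have "fps_nth (fps_deriv (exp_frac (- 1) c)) s = fps_nth (- fps_const c * csch_sq (- 1) c) s"
    using exp_frac_deriv[of "- 1" c] by simp
  then have "of_nat (Suc s) * fps_nth (exp_frac (- 1) c) (Suc s) = - (c * fps_nth (csch_sq (- 1) c) s)"
    by (simp add: mult.assoc flip: fps_const_neg)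
  then have "c * fps_nth (csch_sq (- 1) c) s = - of_nat (Suc s) * fps_nth (exp_frac (- 1) c) (Suc s)"
    by (simp del: of_nat_Suc)
  then have "c ^ 2 * fps_nth (csch_sq (- 1) c) s = - of_nat (Suc s) * (c * fps_nth (exp_frac (- 1) c) (Suc s))"
    by (simp only: power2_eq_square mult.assoc mult.left_commute)
  then show ?thesis unfolding exp_frac_minus_one_nth[OF assms] by (simp add: mult.assoc)
qed

text \<open>The real series, read over the complex numbers, solves the same equation; cancel e^t -
  1.\<close>

lemma bernoulli_fps_of_real: "fps_nth bernoulli_fps n = complex_of_real (fps_nth bernoulli_fps n)"
proof -
  define B where "B = Abs_fps (\<lambda>n. complex_of_real (fps_nth bernoulli_fps n))"
  have "fps_nth (B * (fps_exp 1 - 1)) n = fps_nth fps_X n" for n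
  proof -
    have "fps_nth (B * (fps_exp 1 - 1)) n = of_real (fps_nth (bernoulli_fps * (fps_exp 1 - 1)) n)"
      unfolding fps_mult_nth by (auto simp: B_def intro!: sum.cong)
    then show ?thesis unfolding bernoulli_fps_mult by simp
  qed
  then have "B * (fps_exp 1 - 1) = bernoulli_fps * (fps_exp 1 - 1)"
    unfolding bernoulli_fps_mult fps_eq_iff by simp
  moreover have "(fps_exp 1 - 1 :: complex fps) \<noteq> 0"
    using bernoulli_fps_mult[where ?'a = complex] by auto
  ultimately have "B = bernoulli_fps" by simp
  then have "fps_nth B n = fps_nth bernoulli_fps n" by simp
  then show ?thesis by (simp add: B_def)
qed

section \<open>Evaluation of the cosecant sum\<close>

text \<open>The constant term is z/(z - 1)^2 with z = e^(ix), and z - 1 = e^(ix/2) * 2i sin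
  (x/2).\<close>

lemma csch_sq_cis_nth_0:
  assumes "cis x \<noteq> 1"
  shows "fps_nth (csch_sq (cis x) c) 0 = of_real (- 1 / (4 * sin (x / 2) ^ 2))"
proof -
  let ?z = "cis x"
  have "fps_nth (csch_sq ?z c) 0 = 1 / (?z - 1) + (1 / (?z - 1)) ^ 2"
    by (simp add: csch_sq_def exp_frac_def fps_power_zeroth inverse_eq_divide)
  also have "\<dots> = ?z / (?z - 1) ^ 2"
  proof -
    have "1 / y + (1 / y) ^ 2 = (y + 1) / y ^ 2" if "y \<noteq> 0" for y :: complex
      using that by (simp add: field_simps power2_eq_square)
    from this[of "?z - 1"] show ?thesis using assms by simp
  qed
  also have "(?z - 1) ^ 2 = ?z * of_real (- 4 * sin (x / 2) ^ 2)"
  proof -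
    have z: "?z = cis (x / 2) * cis (x / 2)" by (simp add: cis_mult)
    have "?z - 1 = cis (x / 2) * (cis (x / 2) - cis (- (x / 2)))"
      by (simp add: right_diff_distrib cis_mult)
    also have "cis (x / 2) - cis (- (x / 2)) = 2 * \<i> * of_real (sin (x / 2))"
      by (simp add: complex_eq_iff)
    finally show ?thesis by (simp add: z power_mult_distrib power2_eq_square)
  qed
  finally show ?thesis by (simp add: divide_simps)
qed

lemma csc_power_sum_bern_sq:
  assumes "k \<ge> 1" and "n \<ge> 2"
  shows "csc_power_sum (2*k) n =
    (-1) ^ (k+1) * 2 ^ (2*k-1) *
    (\<Sum>j=1..k. (2 ^ (n-1)) ^ (2*j) * (2 ^ (2*j) - 1) * fps_nth (bern_sq ^ k) (2*(k-j)) * fps_nth bernoulli_fps (2*j))"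
proof -
  define p where "p = n - 1"
  define N :: nat where "N = 2 ^ p"
  have p: "n = Suc p" "p \<ge> 1" using assms by (auto simp: p_def)
  define M :: nat where "M = 2 ^ (n - 2)"
  have NM: "N = 2 * M"
    using assms unfolding N_def M_def p_def by (metis Suc_1 Suc_diff_Suc Suc_le_lessD power_Suc One_nat_def diff_Suc_Suc)
  \<comment> \<open>The angles are twice those in the cosecant sum, because
    \<open>csch_sq_cis_nth_0\<close> halves them.\<close>
  define z where "z = (\<lambda>j. cis ((2 * real j - 1) * pi / 2 ^ p))"
  define h where "h = (\<lambda>j. - 1 / (4 * sin ((2 * real j - 1) * pi / 2 ^ n) ^ 2))"
  have z_ne: "z j \<noteq> 1" for j
  proof
    assume "z j = 1"
    then have "z j ^ (2 ^ p) = 1" by simp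
    moreover have "z j ^ (2 ^ p) = cis (2 * pi * real j - pi)"
      unfolding z_def Complex.DeMoivre by (rule arg_cong[of _ _ cis]) (simp add: field_simps)
    moreover have "cis (2 * pi * real j - pi) = - 1"
      by (simp add: cis_divide[symmetric] cis_multiple_2pi)
    ultimately show False by simp
  qed
  have h: "fps_nth (csch_sq (z j) 1) 0 = of_real (h j)" for j
  proof -
    have "(2 * real j - 1) * pi / 2 ^ p / 2 = (2 * real j - 1) * pi / 2 ^ n" by (simp add: p(1))
    then show ?thesis
      using csch_sq_cis_nth_0[of "(2 * real j - 1) * pi / 2 ^ p" 1] z_ne[of j] 
      unfolding z_def h_def by (simp only:) simp
  qed
  define V where "V = (\<lambda>k. \<Sum>j=1..N. csch_sq (z j) 1 ^ k)"
  define v where "v = (\<lambda>k s. fact s * fps_nth (V k) s)"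
  have V_Suc: "of_nat (2 * k * (2 * k + 1)) * V (Suc k) = fps_deriv (fps_deriv (V k)) - of_nat (k ^ 2) * V k" for k
    unfolding V_def sum_distrib_left fps_deriv_sum csch_sq_power_Suc[OF z_ne] sum_subtractf ..
  have v_Suc: "of_nat (2 * k * (2 * k + 1)) * v (Suc k) s = v k (s + 2) - of_nat (k ^ 2) * v k s" for k s
  proof -
    have c: "fps_nth (of_nat m * F) s = of_nat m * fps_nth F s" for F :: "complex fps" and m
      by (metis fps_mult_left_const_nth fps_of_nat)
    have "of_nat (2 * k * (2 * k + 1)) * fps_nth (V (Suc k)) s
        = of_nat (Suc s) * (of_nat (Suc (Suc s)) * fps_nth (V k) (Suc (Suc s))) - of_nat (k ^ 2) * fps_nth (V k) s"
      using arg_cong[OF V_Suc[of k], of "\<lambda>F. fps_nth F s"] unfolding c fps_sub_nth by simp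
    then have "fact s * (of_nat (2 * k * (2 * k + 1)) * fps_nth (V (Suc k)) s)
        = fact s * (of_nat (Suc s) * (of_nat (Suc (Suc s)) * fps_nth (V k) (Suc (Suc s))) - of_nat (k ^ 2) * fps_nth (V k) s)"
      by (rule arg_cong)
    then show ?thesis unfolding v_def by (simp add: algebra_simps)
  qed
  have v1: "v 1 s = - of_real (fact (s + 1) * (2 ^ (s + 2) - 1) * (2 ^ p) ^ (s + 2) * fps_nth bernoulli_fps (s + 2))" for s
  proof -
    \<comment> \<open>The factor 4^p of \<open>csch_sq_sum\<close> is exactly c^2 for c = 2^p, as
      \<open>csch_sq_minus_one_nth\<close> requires.\<close>
    have "(4 :: complex fps) ^ p = (2 ^ p) ^ 2"
      by (simp add: power2_eq_square flip: power_mult_distrib)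
    then have "V 1 = (2 ^ p) ^ 2 * csch_sq (- 1) (2 ^ p)"
      using csch_sq_sum[where p = p and c = 1] by (simp add: V_def N_def z_def)
    also have "(2 ^ p) ^ 2 = fps_const ((2 ^ p) ^ 2 :: complex)"
      by (simp add: numeral_fps_const flip: fps_const_power)
    finally have "fps_nth (V 1) s = (2 ^ p) ^ 2 * fps_nth (csch_sq (- 1) (2 ^ p)) s"
      by simp
    moreover have two: "(2 ^ p :: complex) \<noteq> 0" by simp
    ultimately have "v 1 s = fact s * (- of_nat (Suc s) * (2 ^ (s + 2) - 1) * (2 ^ p) ^ (s + 2) * fps_nth bernoulli_fps (s + 2))"
      unfolding v_def csch_sq_minus_one_nth[OF two] by simp
    also have "\<dots> = - (of_nat (Suc s) * fact s) * (2 ^ (s + 2) - 1) * (2 ^ p) ^ (s + 2) * fps_nth bernoulli_fps (s + 2)"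
      by (simp only: mult_minus_left mult_minus_right mult_ac)
    finally show ?thesis by (simp add: bernoulli_fps_of_real del: of_nat_Suc)
  qed
  have sum_h: "(\<Sum>j=1..N. h j ^ k) = 2 * ((- 1 / 4) ^ k * csc_power_sum (2*k) n)"
  proof -
    \<comment> \<open>The sum runs over all N roots, twice as many as the cosecant sum has terms.
      The reflection j -> N + 1 - j sends an angle to pi minus it and so swaps the two
      halves.\<close>
    have refl: "h (N + 1 - j) = h j" if "j \<in> {1..N}" for j
    proof -
      have "(2 * real (N + 1 - j) - 1) * pi / 2 ^ n = pi - (2 * real j - 1) * pi / 2 ^ n"
        using that by (simp add: of_nat_diff N_def p field_simps)
      then show ?thesis unfolding h_def by simp
    qed
    have "(\<Sum>j=1..N. h j ^ k) = (\<Sum>j=1..M. h j ^ k) + (\<Sum>j=M+1..N. h j ^ k)"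
      using sum.ub_add_nat[of 1 M "\<lambda>j. h j ^ k" M] by (simp add: NM mult_2)
    also have "(\<Sum>j=M+1..N. h j ^ k) = (\<Sum>j=1..M. h j ^ k)"
      by (rule sum.reindex_bij_witness[of _ "\<lambda>j. N + 1 - j" "\<lambda>j. N + 1 - j"])
         (use refl in \<open>auto simp: NM\<close>)
    also have "(\<Sum>j=1..M. h j ^ k) = (- 1 / 4) ^ k * csc_power_sum (2*k) n"
    proof -
      have "(- 1 / (4 * t ^ 2)) ^ k = (- 1 / 4) ^ k * (1 / t ^ (2*k))" for t :: real
        using power_mult_distrib[of "- 1 / 4" "1 / t ^ 2" k] by (simp add: power_one_over power_mult)
      then show ?thesis unfolding csc_power_sum_def sum_distrib_left M_def h_def by simp
    qed
    finally show ?thesis by simp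
  qed
  define w where "w = (\<lambda>j. (2 ^ p) ^ (2*j) * (2 ^ (2*j) - 1) * fps_nth (bern_sq ^ k) (2*(k-j)) * fps_nth bernoulli_fps (2*j) :: real)"
  \<comment> \<open>The recurrence has real coefficients, so real parts satisfy it too and it can be
    solved over the reals.\<close>
  define v' where "v' = (\<lambda>k s. Re (v k s))"
  have "v' k 0 = (\<Sum>i<k. fps_nth (bern_sq ^ k) (2 * (k - 1 - i)) / fact (2 * i + 1) * v' 1 (0 + 2 * i))"
  proof (rule power_chain_sum)
    fix k s :: nat
    have "Re (of_nat (2 * k * (2 * k + 1)) * v (Suc k) s) = Re (v k (s + 2) - of_nat (k ^ 2) * v k s)"
      unfolding v_Suc ..
    then show "of_nat (2 * k * (2 * k + 1)) * v' (Suc k) s = v' k (s + 2) - of_nat (k ^ 2) * v' k s"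
      by (simp add: v'_def del: of_nat_mult of_nat_power of_nat_add)
  qed (rule assms)
  \<comment> \<open>At s = 2i the factorial in \<open>v1\<close> cancels the denominator (2i + 1)!;
    then j = i + 1.\<close>
  also have "\<dots> = (\<Sum>i<k. - w (Suc i))"
    unfolding v'_def v1 w_def by (intro sum.cong refl) (simp add: fact_reduce del: fact_Suc)
  also have "\<dots> = - (\<Sum>j=1..k. w j)"
    by (simp add: sum_negf sum.atLeast1_atMost_eq)
  also have "v' k 0 = (\<Sum>j=1..N. h j ^ k)"
    by (simp add: v'_def v_def V_def fps_sum_nth fps_power_zeroth h flip: of_real_power of_real_sum)
  finally have sum_w: "2 * ((- 1 / 4) ^ k * csc_power_sum (2*k) n) = - (\<Sum>j=1..k. w j)"
    unfolding sum_h .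
  have "(-4) ^ k * ((- 1 / 4) ^ k) = (1 :: real)"
    by (simp flip: power_mult_distrib)
  then have "2 * csc_power_sum (2*k) n = ((-4) ^ k * ((- 1 / 4) ^ k)) * (2 * csc_power_sum (2*k) n)"
    by (simp only: mult_1)
  also have "\<dots> = (-4) ^ k * (2 * ((- 1 / 4) ^ k * csc_power_sum (2*k) n))"
    by (simp only: mult_ac)
  also have "\<dots> = - ((-4) ^ k) * (\<Sum>j=1..k. w j)"
    unfolding sum_w by simp
  also have "- ((-4) ^ k) = 2 * ((-1) ^ (k+1) * 2 ^ (2*k-1) :: real)"
  proof -
    have "(4 :: real) ^ k = 2 * 2 ^ (2*k-1)"
      using assms power_mult[of "2 :: real" 2 k] by (simp flip: power_Suc)
    then show ?thesis by (simp add: power_minus[of 4])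
  qed
  finally show ?thesis by (simp add: w_def p_def)
qed


section \<open>The limit in n and Euler's formula for zeta at even integers\<close>

lemma riemann_zeta_sums:
  assumes "k \<ge> 1"
  shows "(\<lambda>j. 1 / real (Suc j) ^ (2*k)) sums riemann_zeta (real (2*k))"
proof -
  have "summable (\<lambda>j. 1 / real (Suc j) ^ (2*k))"
    using assms inverse_power_summable[of "2*k", where ?'a = real]
    by (subst summable_Suc_iff) (simp add: inverse_eq_divide)
  moreover have "real (Suc j) powr real (2*k) = real (Suc j) ^ (2*k)" for j
    by (rule powr_realpow) simp
  ultimately show ?thesis unfolding riemann_zeta_def by (simp only: summable_sums)
qed

text \<open>Group the zeta series in consecutive pairs; the even-numbered denominators contribute
  2^(-2k) times the whole series.\<close>

lemma riemann_zeta_odd_sums: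
  assumes "k \<ge> 1"
  shows "(\<lambda>j. 1 / (2 * real j + 1) ^ (2*k)) sums ((1 - 1 / 2 ^ (2*k)) * riemann_zeta (real (2*k)))"
proof -
  let ?f = "\<lambda>j. 1 / real (Suc j) ^ (2*k)"
  have "(\<lambda>i. sum ?f {i * 2..<i * 2 + 2}) sums riemann_zeta (real (2*k))"
    using riemann_zeta_sums[OF assms] by (rule sums_group) simp
  moreover have "sum ?f {i * 2..<i * 2 + 2} = 1 / (2 * real i + 1) ^ (2*k) + 1 / 2 ^ (2*k) * ?f i" for i
  proof -
    have "{i * 2..<i * 2 + 2} = {2 * i, 2 * i + 1}" by auto
    moreover have "sum ?f {2 * i, 2 * i + 1} = ?f (2 * i) + ?f (2 * i + 1)"
      by (subst sum.insert) auto
    moreover have "real (Suc (2 * i + 1)) ^ (2*k) = 2 ^ (2*k) * real (Suc i) ^ (2*k)"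
      unfolding power_mult_distrib[symmetric] by simp
    moreover have "real (Suc (2 * i)) = 2 * real i + 1" by simp
    ultimately show ?thesis by (simp only:) simp
  qed
  ultimately have "(\<lambda>i. 1 / (2 * real i + 1) ^ (2*k) + 1 / 2 ^ (2*k) * ?f i) sums riemann_zeta (real (2*k))"
    by simp
  from sums_diff[OF this sums_mult[OF riemann_zeta_sums[OF assms], of "1 / 2 ^ (2*k)"]]
  show ?thesis by (simp add: left_diff_distrib)
qed

text \<open>A crude bound that supplies the dominating series below. With y = x/2, sin x = 2 sin y
  cos y >= 2y cos^2 y >= y. The first inequality holds as sin t - t cos t has derivative t sin t >=
  0, the second as cos x >= 0.\<close>

lemma sin_ge_half:
  fixes x :: real
  assumes "0 \<le> x" "x \<le> pi / 2"
  shows "x / 2 \<le> sin x"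
proof -
  define y where "y = x / 2"
  have y: "0 \<le> y" "y \<le> pi / 4" "x = 2 * y" using assms by (auto simp: y_def)
  have "sin 0 - 0 * cos 0 \<le> sin y - y * cos y"
  proof (rule DERIV_nonneg_imp_nondecreasing[OF y(1)])
    fix t assume t: "0 \<le> t" "t \<le> y"
    have "((\<lambda>t. sin t - t * cos t) has_real_derivative t * sin t) (at t)"
      by (auto intro!: derivative_eq_intros)
    moreover have "0 \<le> t * sin t"
      using t y pi_gt_zero by (intro mult_nonneg_nonneg sin_ge_zero) auto
    ultimately show "\<exists>d. ((\<lambda>t. sin t - t * cos t) has_real_derivative d) (at t) \<and> 0 \<le> d"
      by blast
  qed
  moreover have "0 \<le> cos y" using y pi_gt_zero by (intro cos_ge_zero) auto
  ultimately have "y * cos y * cos y \<le> sin y * cos y"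
    by (intro mult_right_mono) auto
  moreover have "0 \<le> cos x" using assms by (intro cos_ge_zero) auto
  then have "1 \<le> 2 * cos y ^ 2" unfolding y(3) cos_double_cos by simp
  then have "y * 1 \<le> y * (2 * cos y ^ 2)" using y(1) by (rule mult_left_mono)
  ultimately show ?thesis unfolding y(3) sin_double by (simp add: power2_eq_square)
qed

text \<open>Tannery's theorem: for fixed j, 2^n sin (c / 2^n) tends to c = (2j + 1) pi, and the
  limits sum to the odd part of the zeta series.\<close>

lemma csc_power_sum_tendsto:
  assumes "k \<ge> 1"
  shows "(\<lambda>n. csc_power_sum (2*k) n / (2 ^ n) ^ (2*k)) \<longlonglongrightarrow>
    (1 - 1 / 2 ^ (2*k)) / pi ^ (2*k) * riemann_zeta (real (2*k))"
proof -
  \<comment> \<open>The finite sum is reindexed from 0 and padded with zeros to a series.\<close>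
  define a where "a = (\<lambda>j n. if j < 2 ^ (n-2) then 1 / (2 ^ n * sin ((2 * real j + 1) * pi / 2 ^ n)) ^ (2*k) else 0)"
  define b where "b = (\<lambda>j. 1 / ((2 * real j + 1) * pi) ^ (2*k))"
  have lim: "(\<lambda>n. a j n) \<longlonglongrightarrow> b j" for j
  proof -
    define c where "c = (2 * real j + 1) * pi"
    have c: "c > 0" by (simp add: c_def add_nonneg_pos)
    have pow: "filterlim (\<lambda>n. (1 / 2) ^ n :: real) (at 0) sequentially"
      by (intro filterlim_atI LIMSEQ_power_zero) auto
    have "((\<lambda>x. sin (c * x)) has_real_derivative c) (at 0)"
      by (auto intro!: derivative_eq_intros)
    then have "((\<lambda>h. sin (c * h) / h) \<longlongrightarrow> c) (at 0)"
      by (simp add: DERIV_def)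
    then have "(\<lambda>n. sin (c * (1 / 2) ^ n) / (1 / 2) ^ n) \<longlonglongrightarrow> c"
      by (rule filterlim_compose[OF _ pow])
    then have "(\<lambda>n. 2 ^ n * sin (c / 2 ^ n)) \<longlonglongrightarrow> c"
      by (simp add: power_divide mult.commute)
    then have "(\<lambda>n. 1 / (2 ^ n * sin (c / 2 ^ n)) ^ (2*k)) \<longlonglongrightarrow> 1 / c ^ (2*k)"
      using c by (intro tendsto_intros) auto
    moreover have "eventually (\<lambda>n. 1 / (2 ^ n * sin (c / 2 ^ n)) ^ (2*k) = a j n) sequentially"
      using eventually_ge_at_top[of "j + 2"]
    proof eventually_elim
      case (elim n)
      \<comment> \<open>For n >= j + 2 the index j lies inside the finite range, so the padding does
        not affect the limit.\<close>
      have "j < 2 ^ j" by simp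
      also have "(2 :: nat) ^ j \<le> 2 ^ (n - 2)" using elim by (intro power_increasing) auto
      finally show ?case by (simp add: a_def c_def)
    qed
    ultimately show ?thesis unfolding b_def c_def by (rule Lim_transform_eventually)
  qed
  have bound: "norm (a j n) \<le> 1 / real (Suc j) ^ (2*k)" if n: "n \<ge> 2" for j n
  proof (cases "j < 2 ^ (n-2)")
    case True
    define x where "x = (2 * real j + 1) * pi / 2 ^ n"
    have "2 * real j + 1 \<le> 2 * 2 ^ (n-2)"
    proof -
      have "real (2 * j + 1) \<le> real (2 * 2 ^ (n-2))"
        using True by (subst of_nat_le_iff) linarith
      then show ?thesis by simp
    qed
    also have "2 * 2 ^ (n-2) = (2 ^ n / 2 :: real)"
      using n by (simp add: power_diff)
    finally have "(2 * real j + 1) * pi \<le> 2 ^ n / 2 * pi"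
      by (intro mult_right_mono) auto
    then have "x \<le> pi / 2" by (simp add: x_def field_simps)
    moreover have "0 \<le> x" by (simp add: x_def)
    ultimately have "2 ^ n * (x / 2) \<le> 2 ^ n * sin x" 
      by (intro mult_left_mono sin_ge_half) auto
    \<comment> \<open>Here pi / 2 >= 1 absorbs the factor 1/2 lost in
      \<open>sin_ge_half\<close>.\<close>
    have "real (Suc j) \<le> (2 * real j + 1) * 1" by simp
    also have "\<dots> \<le> (2 * real j + 1) * (pi / 2)"
      using pi_ge_two by (intro mult_left_mono) auto
    also have "\<dots> = 2 ^ n * (x / 2)" by (simp add: x_def)
    also have "\<dots> \<le> 2 ^ n * sin x" by fact
    finally have "real (Suc j) ^ (2*k) \<le> (2 ^ n * sin x) ^ (2*k)"
      by (intro power_mono) auto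
    moreover have "0 \<le> (2 ^ n * sin x) ^ (2*k)" by simp
    ultimately show ?thesis using True by (simp add: a_def x_def[symmetric] frac_le del: of_nat_Suc)
  qed (simp add: a_def)
  have "eventually (\<lambda>(j, n). norm (a j n) \<le> 1 / real (Suc j) ^ (2*k)) (at_top \<times>\<^sub>F sequentially)"
  proof -
    have "eventually (\<lambda>(j::nat, n::nat). n \<ge> 2) (at_top \<times>\<^sub>F sequentially)"
      by (subst eventually_prod2) (auto simp: eventually_ge_at_top)
    then show ?thesis by (rule eventually_mono) (use bound in blast)
  qed
  then have "(\<lambda>n. suminf (\<lambda>j. a j n)) \<longlonglongrightarrow> suminf b"
    using tannerys_theorem[of a b sequentially "\<lambda>j. 1 / real (Suc j) ^ (2*k)"]
      lim sums_summable[OF riemann_zeta_sums[OF assms]] by simp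
  moreover have "suminf (\<lambda>j. a j n) = csc_power_sum (2*k) n / (2 ^ n) ^ (2*k)" for n
  proof -
    have "suminf (\<lambda>j. a j n) = (\<Sum>j<2^(n-2). a j n)"
      by (rule suminf_finite) (auto simp: a_def)
    also have "\<dots> = csc_power_sum (2*k) n / (2 ^ n) ^ (2*k)"
      unfolding csc_power_sum_def sum_divide_distrib One_nat_def sum.atLeast1_atMost_eq
      by (intro sum.cong) (auto simp: a_def power_mult_distrib algebra_simps)
    finally show ?thesis .
  qed
  moreover have "b sums ((1 - 1 / 2 ^ (2*k)) / pi ^ (2*k) * riemann_zeta (real (2*k)))"
    using sums_mult[OF riemann_zeta_odd_sums[OF assms], of "1 / pi ^ (2*k)"]
    by (simp add: b_def power_mult_distrib mult.commute)
  ultimately show ?thesis by (simp add: sums_iff)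
qed

text \<open>Divide the Bernoulli formula by 2^(2kn). The j-th term then decays like 4^(-(k-j)n), so
  only j = k survives, and uniqueness of limits against \<open>csc_power_sum_tendsto\<close> gives
  the value.\<close>

lemma riemann_zeta_even:
  assumes "k \<ge> 1"
  shows "riemann_zeta (real (2*k)) = (-1) ^ (k+1) * 2 ^ (2*k-1) * pi ^ (2*k) * fps_nth bernoulli_fps (2*k)"
proof -
  define B where "B = (\<lambda>j. fps_nth bernoulli_fps (2*j) :: real)"
  define c where "c = (\<lambda>j. (2 ^ (2*j) - 1) * fps_nth (bern_sq ^ k) (2*(k-j)) * B j :: real)"
  define s where "s = ((-1) ^ (k+1) * 2 ^ (2*k-1) :: real)"
  have c_k: "c k = (2 ^ (2*k) - 1) * B k"
    by (simp add: c_def bern_sq_def bernoulli_fps_nth_0 fps_power_zeroth)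
  have lim_j: "(\<lambda>n. (2 ^ (n-1)) ^ (2*j) * c j / (2 ^ n) ^ (2*k)) \<longlonglongrightarrow> (if j = k then c k / 2 ^ (2*k) else 0)"
    if j: "j \<in> {1..k}" for j
  proof (rule LIMSEQ_imp_Suc)
    have "(2 ^ (Suc n-1)) ^ (2*j) * c j / (2 ^ Suc n) ^ (2*k) = c j / 2 ^ (2*k) * ((1 / 2) ^ (2*(k-j))) ^ n" for n
    proof -
      have "2*k = 2*j + 2*(k-j)" using j by auto
      then have "(2 ^ n :: real) ^ (2*k) = (2 ^ n) ^ (2*j) * (2 ^ n) ^ (2*(k-j))"
        by (simp only: power_add[symmetric])
      also have "(2 ^ n :: real) ^ (2*(k-j)) = (2 ^ (2*(k-j))) ^ n"
        by (simp only: power_mult[symmetric] mult.commute)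
      finally have "(2 ^ n :: real) ^ (2*k) = (2 ^ n) ^ (2*j) * (2 ^ (2*(k-j))) ^ n" .
      then show ?thesis by (simp add: power_mult_distrib power_divide)
    qed
    moreover have "(\<lambda>n. c j / 2 ^ (2*k) * ((1 / 2) ^ (2*(k-j))) ^ n) \<longlonglongrightarrow> (if j = k then c k / 2 ^ (2*k) else 0)"
    proof (cases "j = k")
      case False
      then have "(1 / 2 :: real) ^ (2*(k-j)) < 1"
        using j power_strict_decreasing[of 0 "2*(k-j)" "1 / 2 :: real"] by simp
      then have "(\<lambda>n. c j / 2 ^ (2*k) * ((1 / 2) ^ (2*(k-j))) ^ n) \<longlonglongrightarrow> c j / 2 ^ (2*k) * 0"
        by (intro tendsto_mult tendsto_const LIMSEQ_power_zero) simp
      then show ?thesis using False by simp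
    qed simp
    ultimately show "(\<lambda>n. (2 ^ (Suc n-1)) ^ (2*j) * c j / (2 ^ Suc n) ^ (2*k)) \<longlonglongrightarrow> (if j = k then c k / 2 ^ (2*k) else 0)"
      by presburger
  qed
  have "(\<lambda>n. s * (\<Sum>j=1..k. (2 ^ (n-1)) ^ (2*j) * c j / (2 ^ n) ^ (2*k)))
      \<longlonglongrightarrow> s * (\<Sum>j=1..k. if j = k then c k / 2 ^ (2*k) else 0)"
    by (intro tendsto_mult tendsto_const tendsto_sum lim_j)
  then have "(\<lambda>n. s * (\<Sum>j=1..k. (2 ^ (n-1)) ^ (2*j) * c j / (2 ^ n) ^ (2*k)))
      \<longlonglongrightarrow> s * (c k / 2 ^ (2*k))"
    using assms by (simp add: sum.delta)
  moreover have "eventually (\<lambda>n. s * (\<Sum>j=1..k. (2 ^ (n-1)) ^ (2*j) * c j / (2 ^ n) ^ (2*k))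
      = csc_power_sum (2*k) n / (2 ^ n) ^ (2*k)) sequentially"
    using eventually_ge_at_top[of 2]
  proof eventually_elim
    case (elim n)
    show ?case
      unfolding csc_power_sum_bern_sq[OF assms elim] s_def c_def B_def sum_divide_distrib[symmetric]
      by (simp only: mult.assoc times_divide_eq_right)
  qed
  ultimately have "(\<lambda>n. csc_power_sum (2*k) n / (2 ^ n) ^ (2*k)) \<longlonglongrightarrow> s * (c k / 2 ^ (2*k))"
    by (rule Lim_transform_eventually)
  from LIMSEQ_unique[OF csc_power_sum_tendsto[OF assms] this]
  have eq: "(1 - 1 / 2 ^ (2*k)) * (riemann_zeta (real (2*k)) / pi ^ (2*k)) = (1 - 1 / 2 ^ (2*k)) * (s * B k)"
    unfolding c_k by (simp add: diff_divide_distrib algebra_simps)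
  \<comment> \<open>Both limits carry this common factor, nonzero because k >= 1.\<close>
  have "(1 - 1 / 2 ^ (2*k) :: real) \<noteq> 0"
  proof -
    have "1 < (2 :: real) ^ (2*k)" using assms by (intro one_less_power) auto
    then have "1 / (2 :: real) ^ (2*k) < 1" by (subst divide_less_eq_1_pos) simp_all
    then show ?thesis by linarith
  qed
  with eq have "riemann_zeta (real (2*k)) / pi ^ (2*k) = s * B k"
    unfolding mult_cancel_left by blast
  moreover have "pi ^ (2*k) \<noteq> 0" by simp
  ultimately have "riemann_zeta (real (2*k)) = s * B k * pi ^ (2*k)"
    unfolding divide_eq_eq by simp
  then show ?thesis by (simp only: s_def B_def mult_ac)
qed

section \<open>The three forms of the identity\<close>

theorem theorem5p1:
  fixes k n :: nat
  assumes "k \<ge> 1" and "n \<ge> 2"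
  shows "csc_power_sum (2*k) n =
           (\<Sum>j=1..k. (-1) ^ (k+1) *
              (2 ^ (2*j*(n-1) + 2*k - 1) * (2 ^ (2*j) - 1) / (fact (2*(k-j)) * fact (2*j))) *
              bernoulli_gen (real (2*k)) (2*(k-j)) (real k) * bernoulli (2*j))
       \<and> csc_power_sum (2*k) n =
           (\<Sum>j=1..k. (-1) ^ (j+k) *
              (2 ^ (2*j*(n-2) + 2*k) * (2 ^ (2*j) - 1) / (pi ^ (2*j) * fact (2*(k-j)))) *
              bernoulli_gen (real (2*k)) (2*(k-j)) (real k) * riemann_zeta (real (2*j)))
       \<and> csc_power_sum (2*k) n =
           (-1) ^ (k+1) * (2 ^ (2*k-1) / fact (2*k)) *
           (\<Sum>j=1..k. 2 ^ (2*j*n) * ((2 ^ (2*j) - 1) / 2 ^ (2*j)) *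
              real ((2*k) choose (2*j)) *
              bernoulli_gen (real (2*k)) (2*(k-j)) (real k) * bernoulli (2*j))"
proof (intro conjI)
  define p where "p = (\<lambda>j. fps_nth (bern_sq ^ k) (2*(k-j)) :: real)"
  define B where "B = (\<lambda>j. fps_nth bernoulli_fps (2*j) :: real)"
  have gen: "bernoulli_gen (real (2*k)) (2*(k-j)) (real k) = fact (2*(k-j)) * p j" for j
    unfolding p_def by (rule bernoulli_gen_even)
  have bern: "bernoulli (2*j) = fact (2*j) * B j" for j
    by (simp add: bernoulli_def B_def)
  \<comment> \<open>Common form for all three claims, with the factorials still inside the series
    coefficients.\<close>
  have S: "csc_power_sum (2*k) n = (\<Sum>j=1..k. (-1) ^ (k+1) * 2 ^ (2*k-1) * ((2 ^ (n-1)) ^ (2*j) * (2 ^ (2*j) - 1) * p j * B j))"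
    unfolding csc_power_sum_bern_sq[OF assms] sum_distrib_left p_def B_def ..
  show "csc_power_sum (2*k) n =
           (\<Sum>j=1..k. (-1) ^ (k+1) *
              (2 ^ (2*j*(n-1) + 2*k - 1) * (2 ^ (2*j) - 1) / (fact (2*(k-j)) * fact (2*j))) *
              bernoulli_gen (real (2*k)) (2*(k-j)) (real k) * bernoulli (2*j))"
    unfolding S
  proof (intro sum.cong refl)
    fix j
    have "2*j*(n-1) + 2*k - 1 = (n-1)*(2*j) + (2*k-1)" using assms by (simp add: mult_ac)
    then have "(2::real) ^ (2*j*(n-1) + 2*k - 1) = (2 ^ (n-1)) ^ (2*j) * 2 ^ (2*k-1)"
      by (simp only: power_add power_mult)
    then show "(-1) ^ (k+1) * 2 ^ (2*k-1) * ((2 ^ (n-1)) ^ (2*j) * (2 ^ (2*j) - 1) * p j * B j) =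
        (-1) ^ (k+1) * (2 ^ (2*j*(n-1) + 2*k - 1) * (2 ^ (2*j) - 1) / (fact (2*(k-j)) * fact (2*j))) *
              bernoulli_gen (real (2*k)) (2*(k-j)) (real k) * bernoulli (2*j)"
      unfolding gen bern by (simp del: power_Suc)
  qed
  show "csc_power_sum (2*k) n =
           (\<Sum>j=1..k. (-1) ^ (j+k) *
              (2 ^ (2*j*(n-2) + 2*k) * (2 ^ (2*j) - 1) / (pi ^ (2*j) * fact (2*(k-j)))) *
              bernoulli_gen (real (2*k)) (2*(k-j)) (real k) * riemann_zeta (real (2*j)))"
    unfolding S
  proof (intro sum.cong refl)
    fix j assume "j \<in> {1..k}"
    then have j: "j \<ge> 1" by simp
    \<comment> \<open>Splits off the power 2^(2j-1) that \<open>riemann_zeta_even\<close> brings in;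
      j, k >= 1 and n >= 2 make the subtractions genuine.\<close>
    have "(n-1)*(2*j) + (2*k-1) = (2*j*(n-2) + 2*k) + (2*j-1)"
    proof -
      obtain m where "n = m + 2" using assms le_Suc_ex by (metis add.commute)
      then show ?thesis using assms j by (simp add: algebra_simps)
    qed
    then have two: "(2::real) ^ (2*k-1) * (2 ^ (n-1)) ^ (2*j) = 2 ^ (2*j*(n-2) + 2*k) * 2 ^ (2*j-1)"
      by (simp only: power_add[symmetric] power_mult[symmetric] add.commute)
    have sgn: "(-1) ^ (j+k) * (-1) ^ (j+1) = ((-1) ^ (k+1) :: real)"
      by (simp add: power_add)
    have "(-1) ^ (j+k) * (2 ^ (2*j*(n-2) + 2*k) * (2 ^ (2*j) - 1) / (pi ^ (2*j) * fact (2*(k-j)))) *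
              bernoulli_gen (real (2*k)) (2*(k-j)) (real k) * riemann_zeta (real (2*j))
        = ((-1) ^ (j+k) * (-1) ^ (j+1)) * (2 ^ (2*j*(n-2) + 2*k) * 2 ^ (2*j-1)) * (2 ^ (2*j) - 1) * p j * B j"
      unfolding gen riemann_zeta_even[OF j] B_def by (simp del: power_Suc)
    then show "(-1) ^ (k+1) * 2 ^ (2*k-1) * ((2 ^ (n-1)) ^ (2*j) * (2 ^ (2*j) - 1) * p j * B j) =
       (-1) ^ (j+k) * (2 ^ (2*j*(n-2) + 2*k) * (2 ^ (2*j) - 1) / (pi ^ (2*j) * fact (2*(k-j)))) *
              bernoulli_gen (real (2*k)) (2*(k-j)) (real k) * riemann_zeta (real (2*j))"
      unfolding sgn two[symmetric] by (simp only: mult.assoc)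
  qed
  show "csc_power_sum (2*k) n =
           (-1) ^ (k+1) * (2 ^ (2*k-1) / fact (2*k)) *
           (\<Sum>j=1..k. 2 ^ (2*j*n) * ((2 ^ (2*j) - 1) / 2 ^ (2*j)) *
              real ((2*k) choose (2*j)) *
              bernoulli_gen (real (2*k)) (2*(k-j)) (real k) * bernoulli (2*j))"
    unfolding S sum_distrib_left
  proof (intro sum.cong refl)
    fix j assume "j \<in> {1..k}"
    then have "real ((2*k) choose (2*j)) = fact (2*k) / (fact (2*j) * fact (2*(k-j)))"
      by (subst binomial_fact) (auto simp: diff_mult_distrib2)
    moreover have "(2::real) ^ (2*j*n) = (2 ^ (n-1)) ^ (2*j) * 2 ^ (2*j)"
    proof -
      have "2*j*n = (n-1)*(2*j) + 2*j" using assms by (cases n) auto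
      then show ?thesis by (simp only: power_add power_mult)
    qed
    ultimately show "(-1) ^ (k+1) * 2 ^ (2*k-1) * ((2 ^ (n-1)) ^ (2*j) * (2 ^ (2*j) - 1) * p j * B j) =
         (-1) ^ (k+1) * (2 ^ (2*k-1) / fact (2*k)) *
         (2 ^ (2*j*n) * ((2 ^ (2*j) - 1) / 2 ^ (2*j)) * real ((2*k) choose (2*j)) *
              bernoulli_gen (real (2*k)) (2*(k-j)) (real k) * bernoulli (2*j))"
      unfolding gen bern by (simp del: power_Suc)
  qed
qed

end
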